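(* There exists a constant $\gamma>0$ such that $p_4(4,q)>q^2e^{-\gamma(\log q)^{3/4}}$ for all integers $q\ge 4$.
   Context: A $PHF(N;n,q,t)$ is an $N\times n$ matrix over $[q]$ such that for every set of $t$ columns there is a row in which these $t$ columns have pairwise distinct entries; $p_t(N,q)$ is the maximum $n$ for which such a matrix exists. *)

theory Defs
  imports Complex_Main "HOL-Library.FuncSet"
begin

text \<open>The matrix entry in row \<open>i\<close> and column \<open>j\<close> is \<open>A i j\<close>; rows are indexed by
  \<open>{..<N}\<close>, columns by \<open>{..<n}\<close>, and values outside this range are irrelevant.  A set of \<open>t\<close>
  columns is a set of column indices, so repeated columns count separately.\<close>

definition perfect_hash_family ::
    "nat \<Rightarrow> nat \<Rightarrow> nat \<Rightarrow> nat \<Rightarrow> (nat \<Rightarrow> nat \<Rightarrow> nat) \<Rightarrow> bool" where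
  "perfect_hash_family N n q t A \<longleftrightarrow>
     (\<forall>i<N. \<forall>j<n. A i j \<in> {1..q}) \<and>
     (\<forall>C. C \<subseteq> {..<n} \<and> card C = t \<longrightarrow> (\<exists>i<N. inj_on (A i) C))"

definition phf_max :: "nat \<Rightarrow> nat \<Rightarrow> nat \<Rightarrow> nat" where
  "phf_max t N q = Max {n. \<exists>A. perfect_hash_family N n q t A}"

text \<open>For \<open>t \<ge> 2\<close> the maximum in \<open>phf_max\<close> ranges over a finite nonempty set.\<close>

lemma perfect_hash_family_le:
  assumes "perfect_hash_family N n q t A" and "2 \<le> t"
  shows "n \<le> max t (q ^ N)"
proof (cases "n < t")
  case False
  let ?f = "\<lambda>j. restrict (\<lambda>i. A i j) {..<N}"
  have "inj_on ?f {..<n}"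
  proof (rule inj_onI, rule ccontr)
    fix j k assume jk: "j \<in> {..<n}" "k \<in> {..<n}" "?f j = ?f k" "j \<noteq> k"
    have "\<exists>C. {j, k} \<subseteq> C \<and> C \<subseteq> {..<n} \<and> card C = t"
      using exists_subset_between[of "{j, k}" t "{..<n}"] jk False assms(2) by auto
    then obtain C where C: "{j, k} \<subseteq> C" "C \<subseteq> {..<n}" "card C = t" by blast
    then obtain i where i: "i < N" "inj_on (A i) C"
      using assms(1) by (auto simp: perfect_hash_family_def)
    have "A i j = A i k" using fun_cong[OF jk(3), of i] i(1) by simp
    then show False using i(2) C(1) jk(4) by (auto dest: inj_onD)
  qed
  moreover have "?f ` {..<n} \<subseteq> PiE {..<N} (\<lambda>_. {1..q})"
    using assms(1) by (auto simp: perfect_hash_family_def split: if_splits)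
  ultimately have "card {..<n} \<le> card (PiE {..<N} (\<lambda>_. {1..q}))"
    by (intro card_inj_on_le) (auto intro: finite_PiE)
  then show ?thesis by (simp add: card_PiE)
qed simp

lemma finite_phf_sizes:
  assumes "2 \<le> t"
  shows "finite {n. \<exists>A. perfect_hash_family N n q t A}"
  by (rule finite_subset[of _ "{..max t (q ^ N)}"])
    (use perfect_hash_family_le[OF _ assms] in auto)

lemma phf_sizes_nonempty:
  assumes "1 \<le> t"
  shows "0 \<in> {n. \<exists>A. perfect_hash_family N n q t A}"
  using assms by (auto simp: perfect_hash_family_def)

end

theory Submission
  imports Defs
begin

text \<open>
  Let \<open>\<theta>\<close> be a root of \<open>x^3 - 3 x + 1\<close>. Columns are pairs \<open>(u, m)\<close> of short vectors over
  \<open>\<int>[\<theta>]\<close>, and the entry in row \<open>i\<close> is \<open>u + b\<^sub>i m\<close> with \<open>b = (0, 1, \<theta>, 2)\<close>. Two columns agree in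
  at most one row, so four columns that no row separates contain a triangle or a 4-cycle whose edges
  are agreements in different rows. Such a cycle yields a linear relation between the vectors \<open>m\<close>
  whose coefficients are the differences of consecutive \<open>b\<^sub>i\<close>. If the \<open>b\<^sub>i\<close> are monotone along the
  cycle, the relation expresses one \<open>m\<close> as a convex combination of the others, which is
  impossible when all \<open>m\<close> lie on one sphere (Behrend's argument).

  The three real embeddings of \<open>\<int>[\<theta>]\<close> send \<open>\<theta>\<close> to \<open>(-\<infinity>, 0)\<close>, \<open>(0, 1)\<close> and \<open>(1, 2)\<close>, so they realise
  all three cyclic orders of \<open>0, 1, \<theta>, 2\<close>. Hence every 4-cycle is monotone in some embedding, and
  each embedding is injective. Fixing \<open>\<Sum> m\<^sub>t\<^sup>2\<close> in \<open>\<int>[\<theta>]\<close> puts the \<open>m\<close> on a sphere in all three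
  embeddings at once, at the cost of a factor \<open>exp (O(sqrt (ln q)))\<close> only.
\<close>

section \<open>Arithmetic of the cubic ring and its real embeddings\<close>

text \<open>The triple \<open>(a, b, c)\<close> stands for \<open>a + b \<theta> + c \<theta>\<^sup>2\<close>, where \<open>\<theta>^3 = 3 \<theta> - 1\<close>.\<close>

type_synonym cubic = "int \<times> int \<times> int"

definition ev :: "real \<Rightarrow> cubic \<Rightarrow> real" where
  "ev \<theta> = (\<lambda>(a, b, c). of_int a + of_int b * \<theta> + of_int c * \<theta>\<^sup>2)"

text \<open>\<open>entry i u m\<close> is \<open>u + b\<^sub>i m\<close> for the multipliers \<open>b = (0, 1, \<theta>, 2)\<close>; \<open>slope \<theta> i\<close> is the real
  value of \<open>b\<^sub>i\<close>.\<close>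

definition entry :: "nat \<Rightarrow> cubic \<Rightarrow> cubic \<Rightarrow> cubic" where
  "entry i = (\<lambda>(x, y, z) (a, b, c).
     if i = 0 then (x, y, z)
     else if i = 1 then (x + a, y + b, z + c)
     else if i = 2 then (x - c, y + a + 3 * c, z + b)
     else (x + 2 * a, y + 2 * b, z + 2 * c))"

definition slope :: "real \<Rightarrow> nat \<Rightarrow> real" where
  "slope \<theta> i = (if i = 0 then 0 else if i = 1 then 1 else if i = 2 then \<theta> else 2)"

text \<open>The square in the ring, reduced by \<open>\<theta>^3 = 3 \<theta> - 1\<close> and
  \<open>\<theta>^4 = 3 \<theta>^2 - \<theta>\<close>.\<close>

definition sq :: "cubic \<Rightarrow> cubic" where
  "sq = (\<lambda>(a, b, c). (a\<^sup>2 - 2 * b * c, 2 * a * b + 6 * b * c - c\<^sup>2, b\<^sup>2 + 2 * a * c + 3 * c\<^sup>2))"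

text \<open>Kept as a ring element, so that one equality fixes the radius in every
  embedding.\<close>

definition norm_sq :: "nat \<Rightarrow> (nat \<Rightarrow> cubic) \<Rightarrow> cubic" where
  "norm_sq r m = (\<Sum>t<r. fst (sq (m t)), \<Sum>t<r. fst (snd (sq (m t))), \<Sum>t<r. snd (snd (sq (m t))))"

lemma root_power:
  fixes \<theta> :: real
  assumes "\<theta> ^ 3 = 3 * \<theta> - 1"
  shows "\<theta> * \<theta>\<^sup>2 = 3 * \<theta> - 1" "\<theta>\<^sup>2 * \<theta>\<^sup>2 = 3 * \<theta>\<^sup>2 - \<theta>"
proof -
  show 1: "\<theta> * \<theta>\<^sup>2 = 3 * \<theta> - 1"
    using assms by (simp add: power3_eq_cube power2_eq_square)
  have "\<theta>\<^sup>2 * \<theta>\<^sup>2 = \<theta> * (\<theta> * \<theta>\<^sup>2)" by (simp add: power2_eq_square)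
  then show "\<theta>\<^sup>2 * \<theta>\<^sup>2 = 3 * \<theta>\<^sup>2 - \<theta>"
    unfolding 1 by (simp add: algebra_simps power2_eq_square)
qed

lemma ev_entry:
  assumes "\<theta> ^ 3 = 3 * \<theta> - 1"
  shows "ev \<theta> (entry i u m) = ev \<theta> u + slope \<theta> i * ev \<theta> m"
proof -
  obtain x y z a b c where um: "u = (x, y, z)" "m = (a, b, c)"
    by (metis prod_cases3)
  have "\<theta> * (of_int a + of_int b * \<theta> + of_int c * \<theta>\<^sup>2) =
      of_int a * \<theta> + of_int b * \<theta>\<^sup>2 + of_int c * (\<theta> * \<theta>\<^sup>2)"
    by (simp add: algebra_simps power2_eq_square)
  then show ?thesis
    unfolding root_power(1)[OF assms] um ev_def entry_def slope_def
    by (auto simp: algebra_simps)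
qed

lemma ev_sq:
  assumes "\<theta> ^ 3 = 3 * \<theta> - 1"
  shows "ev \<theta> (sq u) = (ev \<theta> u)\<^sup>2"
proof -
  obtain a b c where u: "u = (a, b, c)"
    by (metis prod_cases3)
  have "(of_int a + of_int b * \<theta> + of_int c * \<theta>\<^sup>2)\<^sup>2 =
      (of_int a)\<^sup>2 + 2 * of_int a * of_int b * \<theta> + ((of_int b)\<^sup>2 + 2 * of_int a * of_int c) * \<theta>\<^sup>2
      + 2 * of_int b * of_int c * (\<theta> * \<theta>\<^sup>2) + (of_int c)\<^sup>2 * (\<theta>\<^sup>2 * \<theta>\<^sup>2)"
    by (simp add: algebra_simps power2_eq_square)
  then show ?thesis
    unfolding root_power[OF assms] u ev_def sq_def
    by (simp add: algebra_simps)
qed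

lemma ev_norm_sq:
  assumes "\<theta> ^ 3 = 3 * \<theta> - 1"
  shows "ev \<theta> (norm_sq r m) = (\<Sum>t<r. (ev \<theta> (m t))\<^sup>2)"
  unfolding ev_sq[OF assms, symmetric]
  by (simp add: ev_def norm_sq_def case_prod_beta sum.distrib sum_distrib_right)

text \<open>The norm of \<open>a + b \<theta> + c \<theta>\<^sup>2\<close> is odd unless \<open>a, b, c\<close> are all even, because
  \<open>x^3 - 3 x + 1\<close> is irreducible modulo 2. Infinite descent then replaces the irreducibility
  of the cubic over the rationals.\<close>

lemma ev_triple_eq_0:
  assumes \<theta>: "\<theta> ^ 3 = 3 * \<theta> - 1" and "ev \<theta> (a, b, c) = 0"
  shows "a = 0 \<and> b = 0 \<and> c = 0"
  using assms(2)
proof (induction "nat (\<bar>a\<bar> + \<bar>b\<bar> + \<bar>c\<bar>)" arbitrary: a b c rule: less_induct)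
  case less
  define N where "N = a * ((a + 3 * c)\<^sup>2 - 3 * b\<^sup>2 + b * c) + c * (a * b + c\<^sup>2) - b * (b\<^sup>2 - a * c - 3 * c\<^sup>2)"
  \<comment> \<open>\<open>N\<close> is the norm, and the second factor is the product of the other
    two conjugates; in the product the coefficients of \<theta> and \<theta>^2 cancel.\<close>
  have "of_int N = ev \<theta> (a, b, c) * ev \<theta> ((a + 3 * c)\<^sup>2 - 3 * b\<^sup>2 + b * c, - (a * b + c\<^sup>2), b\<^sup>2 - a * c - 3 * c\<^sup>2)"
  proof -
    define A B C :: real where ABC: "A = of_int a" "B = of_int b" "C = of_int c"
    have "(A + B * \<theta> + C * \<theta>\<^sup>2) * (U + V * \<theta> + W * \<theta>\<^sup>2) =
        A * U + (A * V + B * U) * \<theta> + (A * W + B * V + C * U) * \<theta>\<^sup>2 + (B * W + C * V) * (\<theta> * \<theta>\<^sup>2)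
        + C * W * (\<theta>\<^sup>2 * \<theta>\<^sup>2)" for U V W
      by (simp add: algebra_simps power2_eq_square)
    then show ?thesis
      unfolding root_power[OF \<theta>] N_def ev_def
      by (simp add: ABC[symmetric]) (simp add: algebra_simps power2_eq_square)
  qed
  then have "even N" using less.prems by simp
  then have "even a \<and> even b \<and> even c"
    by (auto simp: N_def)
  then obtain a' b' c' where h: "a = 2 * a'" "b = 2 * b'" "c = 2 * c'"
    by (auto elim!: evenE)
  have "ev \<theta> (a, b, c) = 2 * ev \<theta> (a', b', c')"
    by (simp add: ev_def h algebra_simps)
  then have "ev \<theta> (a', b', c') = 0" using less.prems by simp
  moreover have "nat (\<bar>a'\<bar> + \<bar>b'\<bar> + \<bar>c'\<bar>) < nat (\<bar>a\<bar> + \<bar>b\<bar> + \<bar>c\<bar>)" if "\<not> (a = 0 \<and> b = 0 \<and> c = 0)"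
    using that h by linarith
  ultimately have "a' = 0 \<and> b' = 0 \<and> c' = 0" if "\<not> (a = 0 \<and> b = 0 \<and> c = 0)"
    using less.hyps[of a' b' c'] that by blast
  then show ?case
    using h by auto
qed

lemma ev_inject:
  assumes "\<theta> ^ 3 = 3 * \<theta> - 1" and "ev \<theta> u = ev \<theta> v"
  shows "u = v"
proof -
  obtain x y z a b c where uv: "u = (x, y, z)" "v = (a, b, c)"
    by (metis prod_cases3)
  have "ev \<theta> (x - a, y - b, z - c) = 0"
    using assms(2) by (simp add: uv ev_def algebra_simps)
  then show ?thesis
    using ev_triple_eq_0[OF assms(1), of "x - a" "y - b" "z - c"] by (simp add: uv)
qed

lemma cubic_roots:
  obtains \<theta>\<^sub>1 \<theta>\<^sub>2 \<theta>\<^sub>3 :: real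
  where "\<theta>\<^sub>1 ^ 3 = 3 * \<theta>\<^sub>1 - 1" "\<theta>\<^sub>2 ^ 3 = 3 * \<theta>\<^sub>2 - 1" "\<theta>\<^sub>3 ^ 3 = 3 * \<theta>\<^sub>3 - 1"
    and "\<theta>\<^sub>1 < 0" "0 < \<theta>\<^sub>2" "\<theta>\<^sub>2 < 1" "1 < \<theta>\<^sub>3" "\<theta>\<^sub>3 < 2"
proof -
  define f :: "real \<Rightarrow> real" where "f = (\<lambda>x. x ^ 3 - 3 * x + 1)"
  have cont: "continuous_on S f" for S
    unfolding f_def by (intro continuous_intros)
  have v: "f (-2) = -1" "f 0 = 1" "f 1 = -1" "f 2 = 3" by (simp_all add: f_def)
  obtain p where p: "-2 \<le> p" "p \<le> 0" "f p = 0"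
    using IVT'[of f "-2" 0 0] cont v by auto
  obtain s where s: "0 \<le> s" "s \<le> 1" "f s = 0"
    using IVT2'[of f 1 0 0] cont v by auto
  obtain t where t: "1 \<le> t" "t \<le> 2" "f t = 0"
    using IVT'[of f 1 0 2] cont v by auto
  have ne: "p \<noteq> 0" "s \<noteq> 0" "s \<noteq> 1" "t \<noteq> 1" "t \<noteq> 2"
    using p s t v by auto
  show ?thesis
    using that[of p s t] p s t ne by (simp add: f_def)
qed

section \<open>Spheres and monotone cycles of agreements\<close>

text \<open>As \<open>W\<close> is the weighted mean, the weighted sum of its squared distances to
  \<open>X\<close>, \<open>Y\<close>, \<open>Z\<close> equals
  \<open>a |X|^2 + b |Y|^2 + c |Z|^2 - (a + b + c) |W|^2\<close>, which vanishes on a sphere. The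
  positive weight \<open>a\<close> then forces \<open>W = X\<close>.\<close>

lemma convex_combination_on_sphere:
  fixes X Y Z W :: "nat \<Rightarrow> real"
  assumes eq: "\<And>t. t < r \<Longrightarrow> (a + b + c) * W t = a * X t + b * Y t + c * Z t"
    and pos: "a > 0" "b \<ge> 0" "c \<ge> 0"
    and nX: "(\<Sum>t<r. (X t)\<^sup>2) = R" and nY: "(\<Sum>t<r. (Y t)\<^sup>2) = R"
    and nZ: "(\<Sum>t<r. (Z t)\<^sup>2) = R" and nW: "(\<Sum>t<r. (W t)\<^sup>2) = R"
    and t: "t < r"
  shows "W t = X t"
proof -
  have "(\<Sum>t<r. a * (W t - X t)\<^sup>2 + b * (W t - Y t)\<^sup>2 + c * (W t - Z t)\<^sup>2) =
      (\<Sum>t<r. a * (X t)\<^sup>2 + b * (Y t)\<^sup>2 + c * (Z t)\<^sup>2 - (a + b + c) * (W t)\<^sup>2)"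
  proof (rule sum.cong)
    fix t assume "t \<in> {..<r}"
    then have e: "(a + b + c) * W t = a * X t + b * Y t + c * Z t" using eq by simp
    have "a * (W t - X t)\<^sup>2 + b * (W t - Y t)\<^sup>2 + c * (W t - Z t)\<^sup>2 =
        (a + b + c) * (W t)\<^sup>2 - 2 * W t * (a * X t + b * Y t + c * Z t)
        + a * (X t)\<^sup>2 + b * (Y t)\<^sup>2 + c * (Z t)\<^sup>2"
      by (simp add: algebra_simps power2_eq_square)
    then show "a * (W t - X t)\<^sup>2 + b * (W t - Y t)\<^sup>2 + c * (W t - Z t)\<^sup>2 =
        a * (X t)\<^sup>2 + b * (Y t)\<^sup>2 + c * (Z t)\<^sup>2 - (a + b + c) * (W t)\<^sup>2"
      unfolding e[symmetric] by (simp add: algebra_simps power2_eq_square)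
  qed simp
  also have "\<dots> = 0"
    by (simp add: sum.distrib sum_subtractf sum_distrib_left[symmetric] nX nY nZ nW algebra_simps)
  finally have "(\<Sum>t<r. a * (W t - X t)\<^sup>2 + b * (W t - Y t)\<^sup>2 + c * (W t - Z t)\<^sup>2) = 0" .
  then have "a * (W t - X t)\<^sup>2 + b * (W t - Y t)\<^sup>2 + c * (W t - Z t)\<^sup>2 = 0"
    using pos t by (subst (asm) sum_nonneg_eq_0_iff) auto
  moreover have "b * (W t - Y t)\<^sup>2 \<ge> 0" "c * (W t - Z t)\<^sup>2 \<ge> 0" "a * (W t - X t)\<^sup>2 \<ge> 0"
    using pos by auto
  ultimately have "a * (W t - X t)\<^sup>2 = 0" by linarith
  then show ?thesis using pos by simp
qed

type_synonym column = "(nat \<Rightarrow> cubic) \<times> (nat \<Rightarrow> cubic)"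

definition agree :: "nat \<Rightarrow> nat \<Rightarrow> column \<Rightarrow> column \<Rightarrow> bool" where
  "agree r i p p' \<longleftrightarrow> (\<forall>t<r. entry i (fst p t) (snd p t) = entry i (fst p' t) (snd p' t))"

lemma agree_sym: "agree r i p p' \<Longrightarrow> agree r i p' p"
  by (simp add: agree_def)

lemma agree_ev:
  assumes "\<theta> ^ 3 = 3 * \<theta> - 1" "agree r i p p'" "t < r"
  shows "ev \<theta> (fst p t) + slope \<theta> i * ev \<theta> (snd p t) = ev \<theta> (fst p' t) + slope \<theta> i * ev \<theta> (snd p' t)"
  using assms by (simp add: agree_def flip: ev_entry)

lemma agree_eqI:
  assumes ag: "agree r i p p'" and m: "\<And>t. t < r \<Longrightarrow> snd p t = snd p' t" and t: "t < r"
  shows "fst p t = fst p' t"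
proof -
  obtain \<theta> :: real where \<theta>: "\<theta> ^ 3 = 3 * \<theta> - 1" using cubic_roots by metis
  show ?thesis
    using agree_ev[OF \<theta> ag t] m[OF t] ev_inject[OF \<theta>] by simp
qed

lemma slope_inj:
  assumes \<theta>: "\<theta> ^ 3 = 3 * \<theta> - 1" and "i < 4" "j < 4" "i \<noteq> j"
  shows "slope \<theta> i \<noteq> slope \<theta> j"
proof -
  have "\<theta> \<noteq> 0" "\<theta> \<noteq> 1" "\<theta> \<noteq> 2" using \<theta> by auto
  moreover have "i = 0 \<or> i = 1 \<or> i = 2 \<or> i = 3" "j = 0 \<or> j = 1 \<or> j = 2 \<or> j = 3" using assms by auto
  ultimately show ?thesis using assms(4) by (auto simp: slope_def)
qed

text \<open>Adding the four agreements cancels the vectors \<open>u\<close>. What remains writes the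
  first \<open>m\<close> as a mean of the others, with the increments of the slope as weights. The
  weak inequalities admit a cycle that stays at a vertex and repeats a row.\<close>

lemma monotone_cycle:
  assumes \<theta>: "\<theta> ^ 3 = 3 * \<theta> - 1"
    and ag: "agree r i p\<^sub>1 p\<^sub>2" "agree r j p\<^sub>2 p\<^sub>3" "agree r k p\<^sub>3 p\<^sub>4" "agree r l p\<^sub>4 p\<^sub>1"
    and slopes: "slope \<theta> i < slope \<theta> j" "slope \<theta> j \<le> slope \<theta> k" "slope \<theta> k \<le> slope \<theta> l"
    and ns: "norm_sq r (snd p\<^sub>1) = R" "norm_sq r (snd p\<^sub>2) = R" "norm_sq r (snd p\<^sub>3) = R"
      "norm_sq r (snd p\<^sub>4) = R"
    and t: "t < r"
  shows "snd p\<^sub>1 t = snd p\<^sub>2 t"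
proof -
  let ?s = "slope \<theta>"
  have "ev \<theta> (snd p\<^sub>1 t) = ev \<theta> (snd p\<^sub>2 t)"
  proof (rule convex_combination_on_sphere[where r = r and R = "ev \<theta> R"
        and a = "?s j - ?s i" and b = "?s k - ?s j" and c = "?s l - ?s k"
        and Y = "\<lambda>t. ev \<theta> (snd p\<^sub>3 t)" and Z = "\<lambda>t. ev \<theta> (snd p\<^sub>4 t)"])
    fix t assume "t < r"
    note agree_ev[OF \<theta> ag(1) this] agree_ev[OF \<theta> ag(2) this] agree_ev[OF \<theta> ag(3) this] agree_ev[OF \<theta> ag(4) this]
    then show "(?s j - ?s i + (?s k - ?s j) + (?s l - ?s k)) * ev \<theta> (snd p\<^sub>1 t) =
       (?s j - ?s i) * ev \<theta> (snd p\<^sub>2 t) + (?s k - ?s j) * ev \<theta> (snd p\<^sub>3 t) + (?s l - ?s k) * ev \<theta> (snd p\<^sub>4 t)"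
      by (simp add: algebra_simps)
  qed (use slopes t ns ev_norm_sq[OF \<theta>] in \<open>auto simp flip: ev_norm_sq[OF \<theta>]\<close>)
  then show ?thesis by (rule ev_inject[OF \<theta>])
qed


section \<open>Excluding rainbow cycles\<close>

lemma agree_two_rows:
  assumes "i < 4" "j < 4" "i \<noteq> j" and ag: "agree r i p p'" "agree r j p p'" and t: "t < r"
  shows "snd p t = snd p' t"
proof -
  obtain \<theta> :: real where \<theta>: "\<theta> ^ 3 = 3 * \<theta> - 1" using cubic_roots by metis
  have "(slope \<theta> i - slope \<theta> j) * (ev \<theta> (snd p t) - ev \<theta> (snd p' t)) = 0"
    using agree_ev[OF \<theta> ag(1) t] agree_ev[OF \<theta> ag(2) t] by (simp add: algebra_simps)
  then show ?thesis
    using slope_inj[OF \<theta> assms(1-3)] ev_inject[OF \<theta>] by simp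
qed

text \<open>Extensionality makes equality at the indices below \<open>r\<close> an equality of
  functions, so distinct columns differ at such an index.\<close>

locale columns =
  fixes r :: nat and R :: cubic and P :: "column set"
  assumes extensional: "p \<in> P \<Longrightarrow> fst p \<in> extensional {..<r} \<and> snd p \<in> extensional {..<r}"
    and norm: "p \<in> P \<Longrightarrow> norm_sq r (snd p) = R"
begin

lemma eq_if_agree:
  assumes P: "p \<in> P" "p' \<in> P" and ag: "agree r i p p'" and m: "\<And>t. t < r \<Longrightarrow> snd p t = snd p' t"
  shows "p = p'"
proof (rule prod_eqI; rule extensionalityI[of _ "{..<r}"])
  show "fst p t = fst p' t" if "t \<in> {..<r}" for t
    using agree_eqI[OF ag m] that by simp
qed (use extensional P m in auto)

lemma unique_row:
  assumes "p \<in> P" "p' \<in> P" "p \<noteq> p'" "agree r i p p'" "agree r j p p'" "i < 4" "j < 4"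
  shows "i = j"
  using assms eq_if_agree agree_two_rows by metis

lemma no_monotone_cycle:
  assumes \<theta>: "\<theta> ^ 3 = 3 * \<theta> - 1"
    and P: "p\<^sub>1 \<in> P" "p\<^sub>2 \<in> P" "p\<^sub>3 \<in> P" "p\<^sub>4 \<in> P" "p\<^sub>1 \<noteq> p\<^sub>2"
    and ag: "agree r i p\<^sub>1 p\<^sub>2" "agree r j p\<^sub>2 p\<^sub>3" "agree r k p\<^sub>3 p\<^sub>4" "agree r l p\<^sub>4 p\<^sub>1"
    and slopes: "slope \<theta> i < slope \<theta> j" "slope \<theta> j \<le> slope \<theta> k" "slope \<theta> k \<le> slope \<theta> l"
  shows False
  using monotone_cycle[OF \<theta> ag slopes norm norm norm norm, OF P(1-4)]
    eq_if_agree[OF P(1,2) ag(1)] P(5) by blast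

text \<open>One embedding is enough: rotating or reversing a triangle makes any three distinct
  slopes increasing.\<close>

lemma no_rainbow_triangle:
  assumes P: "p\<^sub>1 \<in> P" "p\<^sub>2 \<in> P" "p\<^sub>3 \<in> P" "p\<^sub>1 \<noteq> p\<^sub>2" "p\<^sub>2 \<noteq> p\<^sub>3" "p\<^sub>3 \<noteq> p\<^sub>1"
    and ag: "agree r i p\<^sub>1 p\<^sub>2" "agree r j p\<^sub>2 p\<^sub>3" "agree r k p\<^sub>3 p\<^sub>1"
    and rows: "i < 4" "j < 4" "k < 4" "i \<noteq> j" "j \<noteq> k" "i \<noteq> k"
  shows False
proof -
  obtain \<theta> :: real where \<theta>: "\<theta> ^ 3 = 3 * \<theta> - 1" using cubic_roots by metis
  have sorted: False
    if "p\<^sub>1 \<in> P" "p\<^sub>2 \<in> P" "p\<^sub>3 \<in> P" "p\<^sub>1 \<noteq> p\<^sub>2"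
      "agree r i p\<^sub>1 p\<^sub>2" "agree r j p\<^sub>2 p\<^sub>3" "agree r k p\<^sub>3 p\<^sub>1"
      "slope \<theta> i < slope \<theta> j" "slope \<theta> j < slope \<theta> k" for p\<^sub>1 p\<^sub>2 p\<^sub>3 i j k
    \<comment> \<open>A triangle is a 4-cycle with a repeated vertex.\<close>
    using no_monotone_cycle[OF \<theta> that(1-3) _ that(4-6) _ that(7), of k] that
    by (simp add: agree_def)
  note ag' = ag[THEN agree_sym]
  have "slope \<theta> i \<noteq> slope \<theta> j" "slope \<theta> j \<noteq> slope \<theta> k" "slope \<theta> i \<noteq> slope \<theta> k"
    using slope_inj[OF \<theta>] rows by auto
  then consider "slope \<theta> i < slope \<theta> j" "slope \<theta> j < slope \<theta> k"
    | "slope \<theta> j < slope \<theta> k" "slope \<theta> k < slope \<theta> i"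
    | "slope \<theta> k < slope \<theta> i" "slope \<theta> i < slope \<theta> j"
    | "slope \<theta> k < slope \<theta> j" "slope \<theta> j < slope \<theta> i"
    | "slope \<theta> j < slope \<theta> i" "slope \<theta> i < slope \<theta> k"
    | "slope \<theta> i < slope \<theta> k" "slope \<theta> k < slope \<theta> j"
    by linarith
  then show False
    using sorted[of p\<^sub>1 p\<^sub>2 p\<^sub>3 i j k] sorted[of p\<^sub>2 p\<^sub>3 p\<^sub>1 j k i] sorted[of p\<^sub>3 p\<^sub>1 p\<^sub>2 k i j]
      sorted[of p\<^sub>1 p\<^sub>3 p\<^sub>2 k j i] sorted[of p\<^sub>3 p\<^sub>2 p\<^sub>1 j i k] sorted[of p\<^sub>2 p\<^sub>1 p\<^sub>3 i k j] P ag ag'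
    by cases auto
qed

text \<open>Row 3 has the largest slope in all three embeddings, and a rotation puts it last. The
  embedding is chosen by the row opposite to it; the cycle is then monotone in one of its two
  directions.\<close>

lemma no_rainbow_quadrilateral:
  assumes P: "p\<^sub>1 \<in> P" "p\<^sub>2 \<in> P" "p\<^sub>3 \<in> P" "p\<^sub>4 \<in> P"
    and ne: "p\<^sub>1 \<noteq> p\<^sub>2" "p\<^sub>2 \<noteq> p\<^sub>3" "p\<^sub>3 \<noteq> p\<^sub>4" "p\<^sub>4 \<noteq> p\<^sub>1"
    and ag: "agree r i p\<^sub>1 p\<^sub>2" "agree r j p\<^sub>2 p\<^sub>3" "agree r k p\<^sub>3 p\<^sub>4" "agree r l p\<^sub>4 p\<^sub>1"
    and rows: "i < 4" "j < 4" "k < 4" "l < 4" "distinct [i, j, k, l]"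
  shows False
proof -
  have last: False
    if P: "p\<^sub>1 \<in> P" "p\<^sub>2 \<in> P" "p\<^sub>3 \<in> P" "p\<^sub>4 \<in> P" and ne: "p\<^sub>1 \<noteq> p\<^sub>2" "p\<^sub>4 \<noteq> p\<^sub>3"
      and ag: "agree r i p\<^sub>1 p\<^sub>2" "agree r j p\<^sub>2 p\<^sub>3" "agree r k p\<^sub>3 p\<^sub>4" "agree r 3 p\<^sub>4 p\<^sub>1"
      and rows: "i < 3" "j < 3" "k < 3" "distinct [i, j, k]" for p\<^sub>1 p\<^sub>2 p\<^sub>3 p\<^sub>4 i j k
  proof -
    obtain \<theta>\<^sub>1 \<theta>\<^sub>2 \<theta>\<^sub>3 :: real
      where \<theta>: "\<theta>\<^sub>1 ^ 3 = 3 * \<theta>\<^sub>1 - 1" "\<theta>\<^sub>2 ^ 3 = 3 * \<theta>\<^sub>2 - 1" "\<theta>\<^sub>3 ^ 3 = 3 * \<theta>\<^sub>3 - 1"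
        and lt: "\<theta>\<^sub>1 < 0" "0 < \<theta>\<^sub>2" "\<theta>\<^sub>2 < 1" "1 < \<theta>\<^sub>3" "\<theta>\<^sub>3 < 2"
      by (rule cubic_roots)
    \<comment> \<open>The embedding in which row \<open>j\<close>, opposite to row 3 in the cycle, has the middle of the
      three smaller slopes.\<close>
    define \<theta> where "\<theta> = (if j = 0 then \<theta>\<^sub>1 else if j = 1 then \<theta>\<^sub>3 else \<theta>\<^sub>2)"
    have root: "\<theta> ^ 3 = 3 * \<theta> - 1" using \<theta> by (simp add: \<theta>_def)
    have cases: "i = 0 \<or> i = 1 \<or> i = 2" "j = 0 \<or> j = 1 \<or> j = 2" "k = 0 \<or> k = 1 \<or> k = 2"
      using rows by auto
    then consider "slope \<theta> i < slope \<theta> j" "slope \<theta> j < slope \<theta> k" "slope \<theta> k < slope \<theta> 3"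
      | "slope \<theta> k < slope \<theta> j" "slope \<theta> j < slope \<theta> i" "slope \<theta> i < slope \<theta> 3"
      using rows(4) lt by (elim disjE) (simp_all add: slope_def \<theta>_def)
    then show False
    proof cases
      case 1
      then show False using no_monotone_cycle[OF root P ne(1) ag] by simp
    next
      case 2
      then show False
        using no_monotone_cycle[OF root P(4,3,2,1) ne(2) ag(3,2,1,4)[THEN agree_sym]] by simp
    qed
  qed
  have "i = 3 \<or> j = 3 \<or> k = 3 \<or> l = 3"
  proof -
    have "{i, j, k, l} = {..<4}"
      using rows by (intro card_subset_eq) auto
    moreover have "3 \<in> {..<4::nat}" by simp
    ultimately have "3 \<in> {i, j, k, l}" by simp
    then show ?thesis by auto
  qed
  then show False
  proof (elim disjE)
    assume [simp]: "l = 3"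
    show False by (rule last[OF P ne(1) ne(3)[symmetric]]) (use ag rows in auto)
  next
    assume [simp]: "i = 3"
    show False by (rule last[OF P(2,3,4,1) ne(2) ne(4)[symmetric]]) (use ag rows in auto)
  next
    assume [simp]: "j = 3"
    show False by (rule last[OF P(3,4,1,2) ne(3) ne(1)[symmetric]]) (use ag rows in auto)
  next
    assume [simp]: "k = 3"
    show False by (rule last[OF P(4,1,2,3) ne(4) ne(2)[symmetric]]) (use ag rows in auto)
  qed
qed

end

section \<open>Separating four columns\<close>

text \<open>A forest on four vertices has at most three edges. The proof counts edges by 0/1
  indicators, which reduces the claim to a finite case split.\<close>

lemma four_edges_contain_cycle:
  assumes d: "distinct [a, b, c, d]"
    and E: "E \<subseteq> {{a, b}, {a, c}, {a, d}, {b, c}, {b, d}, {c, d}}" "card E = 4"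
  obtains x y z where "{x, y, z} \<subseteq> {a, b, c, d}" "distinct [x, y, z]" "{x, y} \<in> E" "{y, z} \<in> E" "{z, x} \<in> E"
  | x y z w where "{x, y, z, w} \<subseteq> {a, b, c, d}" "distinct [x, y, z, w]"
      "{x, y} \<in> E" "{y, z} \<in> E" "{z, w} \<in> E" "{w, x} \<in> E"
proof -
  let ?f = "\<lambda>e. if e \<in> E then 1 else (0::nat)"
  have dist: "distinct [{a, b}, {a, c}, {a, d}, {b, c}, {b, d}, {c, d}]"
    using d by (auto simp: doubleton_eq_iff)
  have "card E = (\<Sum>e\<in>{{a, b}, {a, c}, {a, d}, {b, c}, {b, d}, {c, d}}. ?f e)"
    using E(1) by (simp add: sum.If_cases Int_absorb1)
  also have "\<dots> = ?f {a, b} + ?f {a, c} + ?f {a, d} + ?f {b, c} + ?f {b, d} + ?f {c, d}"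
    using dist by simp
  finally have "?f {a, b} + ?f {a, c} + ?f {a, d} + ?f {b, c} + ?f {b, d} + ?f {c, d} = 4"
    using E(2) by simp
  \<comment> \<open>The four triangles and the three 4-cycles of the complete graph.\<close>
  then have "({a, b} \<in> E \<and> {b, c} \<in> E \<and> {a, c} \<in> E) \<or> ({a, b} \<in> E \<and> {b, d} \<in> E \<and> {a, d} \<in> E)
    \<or> ({a, c} \<in> E \<and> {c, d} \<in> E \<and> {a, d} \<in> E) \<or> ({b, c} \<in> E \<and> {c, d} \<in> E \<and> {b, d} \<in> E)
    \<or> ({a, b} \<in> E \<and> {b, c} \<in> E \<and> {c, d} \<in> E \<and> {a, d} \<in> E)
    \<or> ({a, b} \<in> E \<and> {b, d} \<in> E \<and> {c, d} \<in> E \<and> {a, c} \<in> E)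
    \<or> ({a, c} \<in> E \<and> {b, c} \<in> E \<and> {b, d} \<in> E \<and> {a, d} \<in> E)"
    by (simp split: if_splits)
  then show ?thesis
    using that(1)[of a b c] that(1)[of a b d] that(1)[of a c d] that(1)[of b c d]
      that(2)[of a b c d] that(2)[of a b d c] that(2)[of a c b d] d
    by (auto simp: insert_commute)
qed

text \<open>If every row fails, each row \<open>i\<close> supplies an edge \<open>e i\<close>
  joining two agreeing columns. By \<open>unique_row\<close> these four edges are distinct, so they
  contain a cycle, and its edges come from different rows.\<close>

lemma (in columns) separated:
  assumes "C \<subseteq> P" "card C = 4"
  shows "\<exists>i<4. inj_on (\<lambda>p. restrict (\<lambda>t. entry i (fst p t) (snd p t)) {..<r}) C"
proof (rule ccontr)
  assume neg: "\<not> ?thesis"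
  have "\<forall>i\<in>{..<4}. \<exists>e p p'. e = {p, p'} \<and> p \<in> C \<and> p' \<in> C \<and> p \<noteq> p' \<and> agree r i p p'"
  proof
    fix i :: nat assume i: "i \<in> {..<4}"
    obtain p p' where "p \<in> C" "p' \<in> C" "p \<noteq> p'"
      and eq: "restrict (\<lambda>t. entry i (fst p t) (snd p t)) {..<r} = restrict (\<lambda>t. entry i (fst p' t) (snd p' t)) {..<r}"
      using neg i unfolding inj_on_def by blast
    moreover have "agree r i p p'"
      unfolding agree_def
    proof (intro allI impI)
      fix t assume "t < r"
      then show "entry i (fst p t) (snd p t) = entry i (fst p' t) (snd p' t)"
        using fun_cong[OF eq, of t] by simp
    qed
    ultimately show "\<exists>e p p'. e = {p, p'} \<and> p \<in> C \<and> p' \<in> C \<and> p \<noteq> p' \<and> agree r i p p'" by blast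
  qed
  from bchoice[OF this] obtain e
    where "\<forall>i\<in>{..<4}. \<exists>p p'. e i = {p, p'} \<and> p \<in> C \<and> p' \<in> C \<and> p \<noteq> p' \<and> agree r i p p'" ..
  then have e: "\<exists>p p'. e i = {p, p'} \<and> p \<in> C \<and> p' \<in> C \<and> p \<noteq> p' \<and> agree r i p p'" if "i < 4" for i
    using that by blast
  have agr: "agree r i p p'" if "i < 4" "e i = {p, p'}" for i p p'
    using e[OF that(1)] that(2) by (auto simp: doubleton_eq_iff intro: agree_sym)
  have inj: "inj_on e {..<4}"
  proof (rule inj_onI)
    fix i j :: nat assume ij: "i \<in> {..<4}" "j \<in> {..<4}" "e i = e j"
    obtain p p' where "e i = {p, p'}" "p \<in> C" "p' \<in> C" "p \<noteq> p'" using e[of i] ij(1) by auto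
    then show "i = j"
      using unique_row[of p p' i j] agr[of i p p'] agr[of j p p'] ij assms(1) by auto
  qed
  obtain a b c d where C: "C = {a, b, c, d}" "distinct [a, b, c, d]"
  proof -
    obtain xs where "set xs = C" "distinct xs"
      using finite_distinct_list[of C] assms(2) by (metis card.infinite zero_neq_numeral)
    moreover from this have "length xs = 4" using assms(2) distinct_card by fastforce
    ultimately show ?thesis
      using that by (auto simp: numeral_eq_Suc length_Suc_conv)
  qed
  have sub: "e ` {..<4} \<subseteq> {{a, b}, {a, c}, {a, d}, {b, c}, {b, d}, {c, d}}"
  proof
    fix x assume "x \<in> e ` {..<4}"
    then obtain p p' where "x = {p, p'}" "p \<in> C" "p' \<in> C" "p \<noteq> p'" using e by blast
    then show "x \<in> {{a, b}, {a, c}, {a, d}, {b, c}, {b, d}, {c, d}}"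
      unfolding C(1) by (elim insertE emptyE) (simp_all add: doubleton_eq_iff)
  qed
  have card: "card (e ` {..<4}) = 4" using inj by (simp add: card_image)
  have CP: "x \<in> P" if "x \<in> {a, b, c, d}" for x using that assms(1) C(1) by blast
  from four_edges_contain_cycle[OF C(2) sub card] show False
  proof cases
    case (1 x y z)
    then obtain i j k where ijk: "i < 4" "j < 4" "k < 4" "e i = {x, y}" "e j = {y, z}" "e k = {z, x}"
      by (auto simp: image_iff)
    then have "i \<noteq> j" "j \<noteq> k" "i \<noteq> k" using 1(2) by (auto simp: doubleton_eq_iff)
    then show False
      using no_rainbow_triangle[of x y z i j k] agr ijk CP 1 by auto
  next
    case (2 x y z w)
    then obtain i j k l where ijk: "i < 4" "j < 4" "k < 4" "l < 4"
      "e i = {x, y}" "e j = {y, z}" "e k = {z, w}" "e l = {w, x}"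
      by (auto simp: image_iff)
    then have "distinct [i, j, k, l]" using 2(2) by (auto simp: doubleton_eq_iff)
    then show False
      using no_rainbow_quadrilateral[of x y z w i j k l] agr ijk CP 2 by auto
  qed
qed

section \<open>Counting columns and symbols\<close>

lemma card_le_phf_max:
  fixes P :: "'a set" and V :: "'b set" and F :: "nat \<Rightarrow> 'a \<Rightarrow> 'b"
  assumes t: "2 \<le> t" and fin: "finite P" "finite V" and V: "card V \<le> q"
    and F: "\<And>i p. i < N \<Longrightarrow> p \<in> P \<Longrightarrow> F i p \<in> V"
    and sep: "\<And>C. C \<subseteq> P \<Longrightarrow> card C = t \<Longrightarrow> \<exists>i<N. inj_on (F i) C"
  shows "card P \<le> phf_max t N q"
proof -
  obtain g where g: "bij_betw g {..<card P} P"
    using ex_bij_betw_nat_finite[OF fin(1)] by (auto simp: atLeast0LessThan)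
  obtain h where h: "inj_on h V" "h ` V \<subseteq> {1..q}"
    using inj_on_iff_card_le[of V "{1..q}"] fin V by auto
  have "perfect_hash_family N (card P) q t (\<lambda>i j. h (F i (g j)))"
    unfolding perfect_hash_family_def
  proof (intro conjI allI impI)
    fix i j assume "i < N" "j < card P"
    then show "h (F i (g j)) \<in> {1..q}"
      using F[of i "g j"] bij_betwE[OF g] h(2) by blast
  next
    fix C assume C: "C \<subseteq> {..<card P} \<and> card C = t"
    then have inj: "inj_on g C" using g by (auto simp: bij_betw_def intro: inj_on_subset)
    have gC: "g ` C \<subseteq> P" using C bij_betwE[OF g] by blast
    obtain i where i: "i < N" "inj_on (F i) (g ` C)"
      using sep[OF gC] C inj by (auto simp: card_image)
    have "inj_on (h \<circ> (F i \<circ> g)) C"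
    proof (intro comp_inj_on)
      show "inj_on h ((F i \<circ> g) ` C)"
        by (rule inj_on_subset[OF h(1)]) (use F[OF i(1)] gC in auto)
    qed (use inj i in auto)
    then show "\<exists>i<N. inj_on (\<lambda>j. h (F i (g j))) C"
      using i(1) by (auto simp: comp_def)
  qed
  then show ?thesis
    unfolding phf_max_def using finite_phf_sizes[OF t] by (intro Max_ge) auto
qed

text \<open>The 8 comes from the middle coordinate, where \<open>2 * a * b + 6 * b * c\<close> can
  approach \<open>8 * n\<^sup>2\<close>.\<close>

lemma sq_bounds:
  assumes "a \<in> {0..<n}" "b \<in> {0..<n}" "c \<in> {0..<n}"
  shows "sq (a, b, c) \<in> {- 8 * n\<^sup>2..8 * n\<^sup>2} \<times> {- 8 * n\<^sup>2..8 * n\<^sup>2} \<times> {- 8 * n\<^sup>2..8 * n\<^sup>2}"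
proof -
  have *: "0 \<le> x * y" "x * y \<le> n\<^sup>2" if "x \<in> {0..<n}" "y \<in> {0..<n}" for x y
    using that by (auto simp: power2_eq_square intro!: mult_mono)
  show ?thesis
    using *[OF assms(1,1)] *[OF assms(1,2)] *[OF assms(1,3)] *[OF assms(2,2)] *[OF assms(2,3)]
      *[OF assms(3,3)]
    by (simp only: sq_def prod.case mem_Times_iff fst_conv snd_conv atLeastAtMost_iff mult.assoc
        power2_eq_square[of a] power2_eq_square[of b] power2_eq_square[of c]) linarith
qed

lemma norm_sq_bounds:
  assumes m: "\<And>t. t < r \<Longrightarrow> m t \<in> {0..<n} \<times> {0..<n} \<times> {0..<n}" and K: "K = 8 * int r * n\<^sup>2"
  shows "norm_sq r m \<in> {- K..K} \<times> {- K..K} \<times> {- K..K}"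
proof -
  have sq: "sq (m t) \<in> {- 8 * n\<^sup>2..8 * n\<^sup>2} \<times> {- 8 * n\<^sup>2..8 * n\<^sup>2} \<times> {- 8 * n\<^sup>2..8 * n\<^sup>2}" if "t < r" for t
    using m[OF that] sq_bounds by (cases "m t") auto
  have "(\<Sum>t<r. f t) \<in> {- K..K}" if "\<And>t. t < r \<Longrightarrow> f t \<in> {- 8 * n\<^sup>2..8 * n\<^sup>2}" for f :: "nat \<Rightarrow> int"
  proof -
    have "(\<Sum>t<r. f t) \<le> (\<Sum>t<r. 8 * n\<^sup>2)" "(\<Sum>t<r. - 8 * n\<^sup>2) \<le> (\<Sum>t<r. f t)"
      using that by (intro sum_mono; simp)+
    then show ?thesis by (simp add: K mult_ac)
  qed
  then show ?thesis
    unfolding norm_sq_def using sq by (simp add: mem_Times_iff)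
qed

text \<open>There are \<open>D ^ (3 * r)\<close> vectors with coordinates in \<open>{0..<D}\<close>.
  By pigeonhole some value of \<open>norm_sq\<close> is shared by a fraction of at least
  \<open>1 / (17 * r * D\<^sup>2) ^ 3\<close> of them.\<close>

lemma phf_max_lower_bound:
  assumes r: "r \<ge> 1" and D: "D \<ge> 1" and q: "(6 * D) ^ (3 * r) \<le> q"
  shows "D ^ (6 * r) \<le> phf_max 4 4 q * (17 * r * D\<^sup>2) ^ 3"
proof -
  define B where "B = {0..<int D} \<times> {0..<int D} \<times> {0..<int D}"
  define M where "M = PiE {..<r} (\<lambda>_. B)"
  define K where "K = 8 * int r * (int D)\<^sup>2"
  define W where "W = {- K..K} \<times> {- K..K} \<times> {- K..K}"
  \<comment> \<open>The extremes occur in row 2: \<open>x - c > - D\<close> and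
    \<open>y + a + 3 * c < 5 * D\<close>.\<close>
  define S where "S = {- int D..<5 * int D}"
  define V where "V = PiE {..<r} (\<lambda>_. S \<times> S \<times> S)"
  have fin: "finite M" "finite W" "finite V"
    by (auto simp: M_def B_def W_def V_def S_def intro!: finite_PiE)
  have cardM: "card M = D ^ (3 * r)"
    by (simp add: M_def B_def card_PiE card_cartesian_product power_mult power3_eq_cube mult.assoc)
  have cardV: "card V \<le> q"
  proof -
    have "card S = 6 * D" by (simp add: S_def)
    then have "card V = (6 * D) ^ (3 * r)"
      by (simp only: V_def card_PiE card_cartesian_product finite_lessThan prod_constant card_lessThan
          power_mult power3_eq_cube mult.assoc)
    then show ?thesis using q by simp
  qed
  have K0: "0 \<le> K" by (simp add: K_def)
  have cardW: "card W \<le> (17 * r * D\<^sup>2) ^ 3"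
  proof -
    \<comment> \<open>\<open>{- K..K}\<close> has \<open>16 * r * D\<^sup>2 + 1\<close>
      elements.\<close>
    have "1 \<le> r * D\<^sup>2" using r D by simp
    then have "16 * (r * D\<^sup>2) + 1 \<le> 17 * r * D\<^sup>2" by linarith
    then have "nat (K + 1 + K) \<le> 17 * r * D\<^sup>2"
      unfolding K_def nat_le_iff by (simp flip: zle_int)
    then have "nat (K + 1 + K) ^ 3 \<le> (17 * r * D\<^sup>2) ^ 3" by (rule power_mono) simp
    then show ?thesis
      by (simp add: W_def card_cartesian_product power3_eq_cube mult.assoc)
  qed
  have "norm_sq r \<in> M \<rightarrow> W"
  proof
    fix m assume "m \<in> M"
    then have "m t \<in> {0..<int D} \<times> {0..<int D} \<times> {0..<int D}" if "t < r" for t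
      using that by (auto simp: M_def B_def PiE_iff)
    then show "norm_sq r m \<in> W"
      unfolding W_def using norm_sq_bounds K_def by blast
  qed
  moreover have "W \<noteq> {}" using K0 by (auto simp: W_def)
  ultimately obtain v where v: "card M \<le> card (norm_sq r -` {v} \<inter> M) * card W"
    using pigeonhole_card[of "norm_sq r" M W] fin by auto
  \<comment> \<open>Only \<open>m\<close> is confined to a sphere; \<open>u\<close> ranges over the
    whole box.\<close>
  define P where "P = M \<times> (norm_sq r -` {v} \<inter> M)"
  interpret columns r v P
    by standard (auto simp: P_def M_def PiE_def)
  have "card P \<le> phf_max 4 4 q"
  proof (rule card_le_phf_max[OF _ _ fin(3) cardV _ separated])
    fix i p assume "i < (4::nat)" "p \<in> P"
    then obtain u m where p: "p = (u, m)" "u \<in> M" "m \<in> M" by (auto simp: P_def)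
    have "entry i (u t) (m t) \<in> S \<times> S \<times> S" if "t < r" for t
    proof -
      have "u t \<in> B" "m t \<in> B" using p that by (auto simp: M_def)
      then show ?thesis
        by (cases "u t"; cases "m t") (auto simp: entry_def B_def S_def)
    qed
    then show "restrict (\<lambda>t. entry i (fst p t) (snd p t)) {..<r} \<in> V"
      by (auto simp: V_def p)
  qed (use fin in \<open>auto simp: P_def\<close>)
  moreover have "D ^ (6 * r) \<le> card P * card W"
  proof -
    have "D ^ (6 * r) = card M * card M" by (simp add: cardM flip: power_add)
    also have "\<dots> \<le> card M * (card (norm_sq r -` {v} \<inter> M) * card W)"
      using v by (intro mult_left_mono) auto
    finally show ?thesis by (simp add: P_def card_cartesian_product mult.assoc)
  qed
  ultimately show ?thesis
    using mult_mono[OF _ cardW, of "card P" "phf_max 4 4 q"] by simp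
qed

section \<open>Choice of parameters\<close>

lemma phf_max_pos:
  assumes "q \<ge> 1" "t \<ge> 2"
  shows "phf_max t N q \<ge> 1"
proof -
  have "card C \<noteq> t" if "C \<subseteq> {..<1}" for C :: "nat set"
    using card_mono[OF _ that] assms(2) by simp
  then have "perfect_hash_family N 1 q t (\<lambda>_ _. 1)"
    using assms(1) unfolding perfect_hash_family_def by auto
  then show ?thesis
    unfolding phf_max_def using finite_phf_sizes[OF assms(2)] by (intro Max_ge) auto
qed

text \<open>Rounding in \<open>D\<close> costs a factor exponential in \<open>r\<close>, and the
  pigeonhole step costs about \<open>exp (2 * L / r)\<close>. Taking \<open>r\<close> near
  \<open>sqrt L\<close> balances the two.\<close>

lemma phf_max_sqrt_bound:
  assumes L: "L = ln (real q)" "L \<ge> 900" and q: "q \<ge> 1"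
  shows "(real q)\<^sup>2 * exp (- 140 * sqrt L) \<le> real (phf_max 4 4 q)"
proof -
  define s where "s = sqrt L"
  have s: "s \<ge> 30" "s * s = L"
    using L(2) real_le_rsqrt[of 30 L] by (auto simp: s_def)
  define r where "r = nat \<lceil>s\<rceil>"
  have r: "s \<le> real r" "real r \<le> 2 * s" using s unfolding r_def by linarith+
  have rpos: "real r > 0" using r s by linarith
  \<comment> \<open>This is the real root \<open>q powr (1 / (3 * r))\<close>; rounding
    \<open>x / 6\<close> down keeps the number of symbols at most \<open>q\<close>.\<close>
  define x where "x = exp (L / (3 * real r))"
  define D where "D = nat \<lfloor>x / 6\<rfloor>"
  have qexp: "real q = exp L" using q by (simp add: L)
  have xpow: "x ^ (3 * r) = real q"
    using rpos by (simp add: x_def qexp flip: exp_of_nat_mult)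
  have x6: "x \<ge> 6"
  proof -
    \<comment> \<open>The threshold 900 gives \<open>s \<ge> 30\<close>, hence an exponent of at
      least 5 and \<open>x \<ge> 1 + 5\<close>, so that \<open>D\<close> is positive.\<close>
    have "5 * (3 * real r) \<le> 15 * (2 * s)" using r by simp
    also have "\<dots> \<le> s * s" using s(1) by simp
    finally have "5 \<le> L / (3 * real r)" using rpos s(2) by (simp add: field_simps)
    then show ?thesis unfolding x_def using exp_ge_add_one_self[of "L / (3 * real r)"] by linarith
  qed
  have D: "real D \<le> x / 6" "x / 6 < real D + 1" "D \<ge> 1"
    using x6 unfolding D_def by linarith+
  have "real ((6 * D) ^ (3 * r)) \<le> x ^ (3 * r)"
    using D x6 by (simp only: of_nat_power) (intro power_mono, auto)
  then have "(6 * D) ^ (3 * r) \<le> q" unfolding xpow of_nat_le_iff .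
  then have "D ^ (6 * r) \<le> phf_max 4 4 q * (17 * r * D\<^sup>2) ^ 3"
    using phf_max_lower_bound D(3) rpos by simp
  then have main: "real D ^ (6 * r) \<le> real (phf_max 4 4 q) * (17 * real r * (real D)\<^sup>2) ^ 3"
    by (simp only: of_nat_le_iff of_nat_mult of_nat_numeral of_nat_power flip: of_nat_le_iff[where 'a = real])
  have "(real q)\<^sup>2 = x ^ (6 * r)" by (simp flip: xpow power_mult)
  \<comment> \<open>\<open>x < 6 * (D + 1)\<close>, and \<open>D + 1 \<le> 2 * D\<close>.\<close>
  also have "\<dots> \<le> (12 * real D) ^ (6 * r)"
  proof (rule power_mono)
    have "real D \<ge> 1" using D(3) by simp
    then show "x \<le> 12 * real D" using D(2) by linarith
  qed (use x6 in simp)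
  also have "\<dots> = 12 ^ (6 * r) * real D ^ (6 * r)" by (simp add: power_mult_distrib)
  \<comment> \<open>With \<open>12 \<le> exp 11\<close> and \<open>r \<le> 2 * s\<close>, the first
    factor is at most \<open>exp (66 * r)\<close>, giving 132. The pigeonhole loss gives 8 = 6 + 2,
    from \<open>r ^ 3\<close> and \<open>x ^ 6\<close>; the 17 is absorbed by the 36 in
    \<open>(x / 6)\<^sup>2\<close>.\<close>
  also have "\<dots> \<le> exp (132 * s) * (real (phf_max 4 4 q) * exp (8 * s))"
  proof (rule mult_mono)
    have "(12::real) \<le> exp 11" using exp_ge_add_one_self[of 11] by simp
    then have "(12::real) ^ (6 * r) \<le> exp 11 ^ (6 * r)" by (intro power_mono) auto
    also have "\<dots> = exp (66 * real r)" by (simp flip: exp_of_nat_mult)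
    also have "\<dots> \<le> exp (132 * s)" using r by simp
    finally show "12 ^ (6 * r) \<le> exp (132 * s)" .
    have "17 * real r * (real D)\<^sup>2 \<le> 17 * real r * (x / 6)\<^sup>2"
      using D by (intro mult_left_mono power_mono) auto
    also have "\<dots> \<le> real r * x\<^sup>2" by (simp add: field_simps)
    finally have "(17 * real r * (real D)\<^sup>2) ^ 3 \<le> (real r * x\<^sup>2) ^ 3"
      by (intro power_mono) auto
    also have "\<dots> = real r ^ 3 * x ^ 6" by (simp add: power_mult_distrib flip: power_mult)
    also have "\<dots> \<le> exp (6 * s) * exp (2 * s)"
    proof (rule mult_mono)
      have "real r ^ 3 \<le> exp (real r) ^ 3"
        using exp_ge_add_one_self[of "real r"] by (intro power_mono) linarith+
      also have "\<dots> = exp (3 * real r)" by (simp flip: exp_of_nat_mult)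
      also have "\<dots> \<le> exp (6 * s)" using r by simp
      finally show "real r ^ 3 \<le> exp (6 * s)" .
      have "x ^ 6 = exp (2 * (L / real r))" by (simp add: x_def flip: exp_of_nat_mult)
      also have "L / real r \<le> s"
        using mult_left_mono[OF r(1), of s] s rpos by (simp add: field_simps)
      finally show "x ^ 6 \<le> exp (2 * s)" by simp
    qed auto
    also have "\<dots> = exp (8 * s)" by (simp flip: exp_add)
    finally show "real D ^ (6 * r) \<le> real (phf_max 4 4 q) * exp (8 * s)"
      using main by (meson mult_left_mono of_nat_0_le_iff order_trans)
  qed auto
  also have "\<dots> = real (phf_max 4 4 q) * exp (140 * s)"
    by (simp flip: exp_add)
  finally show ?thesis
    by (simp add: exp_minus field_simps s_def)
qed

theorem theorem6p5:
  "\<exists>\<gamma>::real. \<gamma> > 0 \<and>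
     (\<forall>q::nat. q \<ge> 4 \<longrightarrow>
        real (phf_max 4 4 q) > (real q)\<^sup>2 * exp (- \<gamma> * (ln (real q)) powr (3/4)))"
proof (intro exI[of _ 141] conjI allI impI)
  fix q :: nat assume q: "q \<ge> 4"
  define L where "L = ln (real q)"
  have L1: "L > 1"
  proof -
    have "exp 1 < real q" using exp_le q by linarith
    then have "ln (exp 1) < L" unfolding L_def using q by (subst ln_less_cancel_iff) auto
    then show ?thesis by simp
  qed
  have q2: "(real q)\<^sup>2 = exp (2 * L)" using q by (simp add: L_def exp_double)
  show "(real q)\<^sup>2 * exp (- 141 * ln (real q) powr (3 / 4)) < real (phf_max 4 4 q)"
  proof (cases "L \<ge> 900")
    case True
    \<comment> \<open>Since \<open>L > 1\<close>, the exponent 1/2 is below 3/4; passing from 140 to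
      141 makes the bound strict.\<close>
    have "sqrt L \<le> L powr (3 / 4)"
      using L1 by (simp add: powr_half_sqrt[symmetric] powr_mono)
    moreover have "L powr (3 / 4) > 0" using L1 by simp
    ultimately have "140 * sqrt L < 141 * L powr (3 / 4)" by linarith
    then have "(real q)\<^sup>2 * exp (- 141 * L powr (3 / 4)) < (real q)\<^sup>2 * exp (- 140 * sqrt L)"
      using q by simp
    also have "\<dots> \<le> real (phf_max 4 4 q)"
      using phf_max_sqrt_bound[OF L_def True] q by simp
    finally show ?thesis unfolding L_def .
  next
    case False
    \<comment> \<open>For bounded \<open>L\<close> the claimed bound is trivial:
      \<open>2 * L \<le> 60 * L powr (3 / 4)\<close>, so it lies below 1, and one column always
      exists.\<close>
    have "L powr (1 / 4) \<le> 900 powr (1 / 4)" using L1 False by (intro powr_mono2) auto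
    also have "\<dots> \<le> 900 powr (1 / 2)" by (intro powr_mono) auto
    also have "\<dots> = 30" by (simp add: powr_half_sqrt)
    finally have "L powr (1 / 4) * L powr (3 / 4) \<le> 30 * L powr (3 / 4)"
      by (intro mult_right_mono) auto
    moreover have "L powr (1 / 4) * L powr (3 / 4) = L" using L1 by (simp flip: powr_add)
    moreover have "L powr (3 / 4) > 0" using L1 by simp
    ultimately have "2 * L - 141 * L powr (3 / 4) < 0" by linarith
    then have "(real q)\<^sup>2 * exp (- 141 * L powr (3 / 4)) < 1"
      by (simp add: q2 flip: exp_add)
    then show ?thesis
      using phf_max_pos[of q 4 4] q by (simp add: L_def)
  qed
qed simp

end
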